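(* Let $\mathcal{A}$ be a finite alphabet of modalities and $L$ a $2$-finite normal modal logic over $\mathcal{A}$. Let $p$ and $q$ be distinct variables. Then there exists $m<\omega$ such that: (1) $L\vdash q\to[\Diamond_{\mathcal{A}}^{m+1}p\to\Diamond_{\mathcal{A}}^{\le m}p]_q$; and (2) if moreover $L$ is Kripke complete, then there exists $h<\omega$ such that $L\vdash q\to[B_h^{[m]}]_q$, where $q$ is chosen not to occur in $B_h^{[m]}$.
   Context: Formulas over $\mathcal{A}$ are built from variables $p_0,p_1,\ldots$ with $\bot,\to$, $\Diamond\in\mathcal{A}$. A normal modal logic is a set of formulas containing classical tautologies, $\neg\Diamond\bot$ and $\Diamond(p_0\vee p_1)\to\Diamond p_0\vee\Diamond p_1$ for each $\Diamond$, closed under modus ponens, substitution and monotonicity ($\varphi\to\psi\in L$ implies $\Diamond\varphi\to\Diamond\psi\in L$). $L$ is $2$-finite if only finitely many formulas in $p_0,p_1$ are pairwise non-equivalent modulo $L$; $L$ is Kripke complete if it is the set of formulas valid in some class of Kripke frames. Abbreviations: $\Diamond_{\mathcal{A}}\varphi=\bigvee_{\Diamond\in\mathcal{A}}\Diamond\varphi$, $\Box_{\mathcal{A}}=\neg\Diamond_{\mathcal{A}}\neg$, $\Diamond_{\mathcal{A}}^0\varphi=\varphi$, $\Diamond_{\mathcal{A}}^{i+1}\varphi=\Diamond_{\mathcal{A}}^i\Diamond_{\mathcal{A}}\varphi$, $\Diamond_{\mathcal{A}}^{\le m}\varphi=\bigvee_{i\le m}\Diamond_{\mathcal{A}}^i\varphi$,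 $\Box_{\mathcal{A}}^{\le m}\varphi=\neg\Diamond_{\mathcal{A}}^{\le m}\neg\varphi$. The formulas $B_h^{[m]}$ are: $B_0^{[m]}=\bot$, $B_h^{[m]}=p_h\to\Box_{\mathcal{A}}^{\le m}(\Diamond_{\mathcal{A}}^{\le m}p_h\vee B_{h-1}^{[m]})$. The relativization $[\varphi]_\xi$ is: $[\bot]_\xi=\bot$, $[p]_\xi=p$, $[\psi_1\to\psi_2]_\xi=[\psi_1]_\xi\to[\psi_2]_\xi$, $[\Diamond\psi]_\xi=\Diamond(\xi\wedge[\psi]_\xi)$ for $\Diamond\in\mathcal{A}$ (so $\Diamond_{\mathcal{A}}$ etc. are relativized after unfolding the abbreviations). *)

theory Defs
  imports Main
begin

text \<open>
  Formulas whose modalities are drawn from a type \<open>'m\<close>. The alphabet of a logic is a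
  (possibly empty) finite set \<open>A :: 'm set\<close>, so formulas over \<open>A\<close> are the
  formulas that only use modalities from \<open>A\<close>.
\<close>

datatype (modalities: 'm) fm =
    Var nat
  | Bot  ("\<^bold>\<bottom>")
  | Imp "'m fm" "'m fm"  (infixr "\<^bold>\<longrightarrow>" 60)
  | Dia 'm "'m fm"  ("\<^bold>\<diamond>")

definition fms :: "'m set \<Rightarrow> 'm fm set" where
  "fms A = {\<phi>. modalities \<phi> \<subseteq> A}"

primrec vars :: "'m fm \<Rightarrow> nat set" where
  "vars (Var i) = {i}"
| "vars \<^bold>\<bottom> = {}"
| "vars (\<phi> \<^bold>\<longrightarrow> \<psi>) = vars \<phi> \<union> vars \<psi>"
| "vars (\<^bold>\<diamond> d \<phi>) = vars \<phi>"

definition Neg :: "'m fm \<Rightarrow> 'm fm"  ("\<^bold>\<not> _" [80] 80) where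
  "\<^bold>\<not> \<phi> = (\<phi> \<^bold>\<longrightarrow> \<^bold>\<bottom>)"

definition Or :: "'m fm \<Rightarrow> 'm fm \<Rightarrow> 'm fm"  (infixr "\<^bold>\<or>" 65) where
  "\<phi> \<^bold>\<or> \<psi> = (\<^bold>\<not> \<phi> \<^bold>\<longrightarrow> \<psi>)"

definition And :: "'m fm \<Rightarrow> 'm fm \<Rightarrow> 'm fm"  (infixr "\<^bold>\<and>" 70) where
  "\<phi> \<^bold>\<and> \<psi> = \<^bold>\<not> (\<phi> \<^bold>\<longrightarrow> \<^bold>\<not> \<psi>)"

definition Iff :: "'m fm \<Rightarrow> 'm fm \<Rightarrow> 'm fm"  (infix "\<^bold>\<longleftrightarrow>" 55) where
  "(\<phi> \<^bold>\<longleftrightarrow> \<psi>) = (\<phi> \<^bold>\<longrightarrow> \<psi>) \<^bold>\<and> (\<psi> \<^bold>\<longrightarrow> \<phi>)"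

primrec subst :: "(nat \<Rightarrow> 'm fm) \<Rightarrow> 'm fm \<Rightarrow> 'm fm" where
  "subst \<sigma> (Var i) = \<sigma> i"
| "subst \<sigma> \<^bold>\<bottom> = \<^bold>\<bottom>"
| "subst \<sigma> (\<phi> \<^bold>\<longrightarrow> \<psi>) = (subst \<sigma> \<phi> \<^bold>\<longrightarrow> subst \<sigma> \<psi>)"
| "subst \<sigma> (\<^bold>\<diamond> d \<phi>) = \<^bold>\<diamond> d (subst \<sigma> \<phi>)"

text \<open>
  A classical tautology is true under every truth assignment that respects
  \<open>\<bottom>\<close> and \<open>\<rightarrow>\<close>; variables and formulas \<open>\<diamond>\<phi>\<close> are treated as
  propositional atoms.
\<close>

definition truth_assignment :: "('m fm \<Rightarrow> bool) \<Rightarrow> bool" where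
  "truth_assignment e \<longleftrightarrow> \<not> e \<^bold>\<bottom> \<and> (\<forall>\<phi> \<psi>. e (\<phi> \<^bold>\<longrightarrow> \<psi>) \<longleftrightarrow> (e \<phi> \<longrightarrow> e \<psi>))"

definition tautology :: "'m fm \<Rightarrow> bool" where
  "tautology \<phi> \<longleftrightarrow> (\<forall>e. truth_assignment e \<longrightarrow> e \<phi>)"

definition normal_logic :: "'m set \<Rightarrow> 'm fm set \<Rightarrow> bool" where
  "normal_logic A L \<longleftrightarrow>
     L \<subseteq> fms A \<and>
     (\<forall>\<phi>\<in>fms A. tautology \<phi> \<longrightarrow> \<phi> \<in> L) \<and>
     (\<forall>d\<in>A. \<^bold>\<not> \<^bold>\<diamond> d \<^bold>\<bottom> \<in> L) \<and>
     (\<forall>d\<in>A. (\<^bold>\<diamond> d (Var 0 \<^bold>\<or> Var 1) \<^bold>\<longrightarrow> \<^bold>\<diamond> d (Var 0) \<^bold>\<or> \<^bold>\<diamond> d (Var 1)) \<in> L) \<and>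
     (\<forall>\<phi> \<psi>. (\<phi> \<^bold>\<longrightarrow> \<psi>) \<in> L \<longrightarrow> \<phi> \<in> L \<longrightarrow> \<psi> \<in> L) \<and>
     (\<forall>\<sigma> \<phi>. range \<sigma> \<subseteq> fms A \<longrightarrow> \<phi> \<in> L \<longrightarrow> subst \<sigma> \<phi> \<in> L) \<and>
     (\<forall>d\<in>A. \<forall>\<phi> \<psi>. (\<phi> \<^bold>\<longrightarrow> \<psi>) \<in> L \<longrightarrow> (\<^bold>\<diamond> d \<phi> \<^bold>\<longrightarrow> \<^bold>\<diamond> d \<psi>) \<in> L)"

definition kfms :: "'m set \<Rightarrow> nat \<Rightarrow> 'm fm set" where
  "kfms A k = {\<phi> \<in> fms A. vars \<phi> \<subseteq> {..<k}}"

definition k_finite :: "'m set \<Rightarrow> nat \<Rightarrow> 'm fm set \<Rightarrow> bool" where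
  "k_finite A k L \<longleftrightarrow>
     finite (kfms A k // {(\<phi>, \<psi>). \<phi> \<in> kfms A k \<and> \<psi> \<in> kfms A k \<and> (\<phi> \<^bold>\<longleftrightarrow> \<psi>) \<in> L})"

type_synonym ('m, 'w) frame = "'w set \<times> ('m \<Rightarrow> ('w \<times> 'w) set)"

definition kripke_frame :: "'m set \<Rightarrow> ('m, 'w) frame \<Rightarrow> bool" where
  "kripke_frame A F \<longleftrightarrow> fst F \<noteq> {} \<and> (\<forall>d\<in>A. snd F d \<subseteq> fst F \<times> fst F)"

primrec holds :: "('m, 'w) frame \<Rightarrow> (nat \<Rightarrow> 'w set) \<Rightarrow> 'w \<Rightarrow> 'm fm \<Rightarrow> bool" where
  "holds F V w (Var i) \<longleftrightarrow> w \<in> V i"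
| "holds F V w \<^bold>\<bottom> \<longleftrightarrow> False"
| "holds F V w (\<phi> \<^bold>\<longrightarrow> \<psi>) \<longleftrightarrow> (holds F V w \<phi> \<longrightarrow> holds F V w \<psi>)"
| "holds F V w (\<^bold>\<diamond> d \<phi>) \<longleftrightarrow> (\<exists>v. (w, v) \<in> snd F d \<and> holds F V v \<phi>)"

definition frame_valid :: "('m, 'w) frame \<Rightarrow> 'm fm \<Rightarrow> bool" where
  "frame_valid F \<phi> \<longleftrightarrow>
     (\<forall>V. (\<forall>i. V i \<subseteq> fst F) \<longrightarrow> (\<forall>w\<in>fst F. holds F V w \<phi>))"

text \<open>
  HOL cannot quantify over frames on worlds of all types at once, so Kripke
  completeness takes the type \<open>'w\<close> of worlds as a parameter. Worlds form an arbitrary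
  nonempty subset of \<open>'w\<close>, and \<open>'w\<close> is unconstrained: no bound on the
  cardinality of frames is built in.
\<close>

definition kripke_complete :: "'w itself \<Rightarrow> 'm set \<Rightarrow> 'm fm set \<Rightarrow> bool" where
  "kripke_complete _ A L \<longleftrightarrow>
     (\<exists>\<F> :: ('m, 'w) frame set.
        (\<forall>F\<in>\<F>. kripke_frame A F) \<and> L = {\<phi> \<in> fms A. \<forall>F\<in>\<F>. frame_valid F \<phi>})"

text \<open>
  Finite disjunctions are formed along a list; the empty one is \<open>\<bottom>\<close>. For the
  disjunction over the alphabet some enumeration of \<open>A\<close> is fixed; its order is
  immaterial up to equivalence in any normal logic.
\<close>

definition Disj :: "'m fm list \<Rightarrow> 'm fm" where
  "Disj \<phi>s = foldr (\<^bold>\<or>) \<phi>s \<^bold>\<bottom>"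

definition enumeration :: "'m set \<Rightarrow> 'm list" where
  "enumeration A = (SOME ds. set ds = A \<and> distinct ds)"

definition DiaA :: "'m set \<Rightarrow> 'm fm \<Rightarrow> 'm fm" where
  "DiaA A \<phi> = Disj (map (\<lambda>d. \<^bold>\<diamond> d \<phi>) (enumeration A))"

primrec DiaA_pow :: "'m set \<Rightarrow> nat \<Rightarrow> 'm fm \<Rightarrow> 'm fm" where
  "DiaA_pow A 0 \<phi> = \<phi>"
| "DiaA_pow A (Suc i) \<phi> = DiaA_pow A i (DiaA A \<phi>)"

definition DiaA_le :: "'m set \<Rightarrow> nat \<Rightarrow> 'm fm \<Rightarrow> 'm fm" where
  "DiaA_le A m \<phi> = Disj (map (\<lambda>i. DiaA_pow A i \<phi>) [0..<Suc m])"

definition BoxA_le :: "'m set \<Rightarrow> nat \<Rightarrow> 'm fm \<Rightarrow> 'm fm" where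
  "BoxA_le A m \<phi> = \<^bold>\<not> DiaA_le A m (\<^bold>\<not> \<phi>)"

primrec Bfm :: "'m set \<Rightarrow> nat \<Rightarrow> nat \<Rightarrow> 'm fm" where
  "Bfm A m 0 = \<^bold>\<bottom>"
| "Bfm A m (Suc h) =
     (Var (Suc h) \<^bold>\<longrightarrow> BoxA_le A m (DiaA_le A m (Var (Suc h)) \<^bold>\<or> Bfm A m h))"

primrec relativize :: "'m fm \<Rightarrow> 'm fm \<Rightarrow> 'm fm" where
  "relativize \<xi> (Var i) = Var i"
| "relativize \<xi> \<^bold>\<bottom> = \<^bold>\<bottom>"
| "relativize \<xi> (\<phi> \<^bold>\<longrightarrow> \<psi>) = (relativize \<xi> \<phi> \<^bold>\<longrightarrow> relativize \<xi> \<psi>)"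
| "relativize \<xi> (\<^bold>\<diamond> d \<phi>) = \<^bold>\<diamond> d (\<xi> \<^bold>\<and> relativize \<xi> \<phi>)"

end

(* Both parts are pigeonhole arguments on sequences of relativized formulas in two variables, with
   q naming a subset Q of a frame.
   (1) The formulas [Dia^{<=n} p]_q form a chain of disjunctions, so two of them being equivalent
   modulo L makes the later disjuncts redundant; this step is purely propositional.
   (2) By (1), Dia^{<=m} is, on every restriction of a frame of L to a subset Q, the modality of
   the reflexive transitive closure. A refutation of B_h on Q yields a strict chain of h points in
   that preorder. Number the chain from its top and let the rank of a point be the largest index of
   a chain element above it; ranks never increase along the preorder. Colouring points by the parity
   of their rank, the formula "there is an alternating path with n+1 vertices" holds exactly at the
   chain elements of rank at least n, so long chains separate many such formulas. *)
theory Submission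
  imports Defs
begin

section \<open>Propositional reasoning in normal logics\<close>

lemma truth_assignment_simps [simp]:
  assumes "truth_assignment e"
  shows "\<not> e \<^bold>\<bottom>"
    and "e (\<phi> \<^bold>\<longrightarrow> \<psi>) \<longleftrightarrow> (e \<phi> \<longrightarrow> e \<psi>)"
    and "e (\<^bold>\<not> \<phi>) \<longleftrightarrow> \<not> e \<phi>"
    and "e (\<phi> \<^bold>\<or> \<psi>) \<longleftrightarrow> e \<phi> \<or> e \<psi>"
    and "e (\<phi> \<^bold>\<and> \<psi>) \<longleftrightarrow> e \<phi> \<and> e \<psi>"
    and "e (\<phi> \<^bold>\<longleftrightarrow> \<psi>) \<longleftrightarrow> (e \<phi> \<longleftrightarrow> e \<psi>)"
    and "e (Disj \<phi>s) \<longleftrightarrow> (\<exists>\<phi>\<in>set \<phi>s. e \<phi>)"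
proof -
  show bot: "\<not> e \<^bold>\<bottom>" and imp: "e (\<phi> \<^bold>\<longrightarrow> \<psi>) \<longleftrightarrow> (e \<phi> \<longrightarrow> e \<psi>)" for \<phi> \<psi>
    using assms by (auto simp: truth_assignment_def)
  show neg: "e (\<^bold>\<not> \<phi>) \<longleftrightarrow> \<not> e \<phi>" for \<phi>
    by (simp add: Neg_def bot imp)
  show or: "e (\<phi> \<^bold>\<or> \<psi>) \<longleftrightarrow> e \<phi> \<or> e \<psi>" for \<phi> \<psi>
    by (auto simp: Or_def neg imp)
  show conj: "e (\<phi> \<^bold>\<and> \<psi>) \<longleftrightarrow> e \<phi> \<and> e \<psi>" for \<phi> \<psi>
    by (simp add: And_def neg imp)
  show "e (\<phi> \<^bold>\<longleftrightarrow> \<psi>) \<longleftrightarrow> (e \<phi> \<longleftrightarrow> e \<psi>)"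
    by (auto simp: Iff_def conj imp)
  show "e (Disj \<phi>s) \<longleftrightarrow> (\<exists>\<phi>\<in>set \<phi>s. e \<phi>)"
    by (induction \<phi>s) (auto simp: Disj_def bot or)
qed

text \<open>Turns a check over truth assignments, which treat diamonds as atoms, into membership in
  \<open>L\<close>.\<close>

lemma normal_logic_taut_consequence:
  assumes L: "normal_logic A L" and \<phi>: "\<phi> \<in> L" and \<psi>: "\<psi> \<in> fms A"
    and "\<And>e. truth_assignment e \<Longrightarrow> e \<phi> \<Longrightarrow> e \<psi>"
  shows "\<psi> \<in> L"
proof -
  have "\<phi> \<in> fms A" using L \<phi> by (auto simp: normal_logic_def)
  then have "(\<phi> \<^bold>\<longrightarrow> \<psi>) \<in> fms A" using \<psi> by (simp add: fms_def)
  moreover have "tautology (\<phi> \<^bold>\<longrightarrow> \<psi>)" unfolding tautology_def using truth_assignment_simps(2) assms(4) by blast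
  ultimately have "(\<phi> \<^bold>\<longrightarrow> \<psi>) \<in> L" using L unfolding normal_logic_def by blast
  then show ?thesis using L \<phi> unfolding normal_logic_def by blast
qed

lemma modalities_connectives [simp]:
  "modalities (\<^bold>\<not> \<phi>) = modalities \<phi>"
  "modalities (\<phi> \<^bold>\<or> \<psi>) = modalities \<phi> \<union> modalities \<psi>"
  "modalities (\<phi> \<^bold>\<and> \<psi>) = modalities \<phi> \<union> modalities \<psi>"
  "modalities (\<phi> \<^bold>\<longleftrightarrow> \<psi>) = modalities \<phi> \<union> modalities \<psi>"
  "modalities (Disj \<phi>s) = (\<Union>\<phi>\<in>set \<phi>s. modalities \<phi>)"
proof -
  show neg: "modalities (\<^bold>\<not> \<phi>) = modalities \<phi>" for \<phi> :: "'m fm"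
    by (simp add: Neg_def)
  show or: "modalities (\<phi> \<^bold>\<or> \<psi>) = modalities \<phi> \<union> modalities \<psi>" for \<phi> \<psi> :: "'m fm"
    by (simp add: Or_def neg)
  show conj: "modalities (\<phi> \<^bold>\<and> \<psi>) = modalities \<phi> \<union> modalities \<psi>" for \<phi> \<psi> :: "'m fm"
    by (simp add: And_def neg)
  show "modalities (\<phi> \<^bold>\<longleftrightarrow> \<psi>) = modalities \<phi> \<union> modalities \<psi>"
    by (auto simp: Iff_def conj)
  show "modalities (Disj \<phi>s) = (\<Union>\<phi>\<in>set \<phi>s. modalities \<phi>)"
    by (induction \<phi>s) (auto simp: Disj_def or)
qed

lemma vars_connectives [simp]:
  "vars (\<^bold>\<not> \<phi>) = vars \<phi>"
  "vars (\<phi> \<^bold>\<or> \<psi>) = vars \<phi> \<union> vars \<psi>"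
  "vars (\<phi> \<^bold>\<and> \<psi>) = vars \<phi> \<union> vars \<psi>"
  "vars (Disj \<phi>s) = (\<Union>\<phi>\<in>set \<phi>s. vars \<phi>)"
proof -
  show neg: "vars (\<^bold>\<not> \<phi>) = vars \<phi>" for \<phi> :: "'m fm"
    by (simp add: Neg_def)
  show or: "vars (\<phi> \<^bold>\<or> \<psi>) = vars \<phi> \<union> vars \<psi>" for \<phi> \<psi> :: "'m fm"
    by (simp add: Or_def neg)
  show "vars (\<phi> \<^bold>\<and> \<psi>) = vars \<phi> \<union> vars \<psi>"
    by (simp add: And_def neg)
  show "vars (Disj \<phi>s) = (\<Union>\<phi>\<in>set \<phi>s. vars \<phi>)"
    by (induction \<phi>s) (auto simp: Disj_def or)
qed

text \<open>Sending n to the class of \<open>\<phi> n\<close> cannot be injective, as only finitely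
  many classes exist. Once two classes coincide, reflexivity puts \<open>\<phi> j\<close> into the
  class of \<open>\<phi> i\<close>, which is the desired equivalence.\<close>

lemma k_finite_pigeonhole:
  fixes \<phi> :: "nat \<Rightarrow> 'm fm"
  assumes L: "normal_logic A L" and fin: "k_finite A k L" and \<phi>: "\<And>n. \<phi> n \<in> kfms A k"
  obtains i j where "i < j" "(\<phi> i \<^bold>\<longleftrightarrow> \<phi> j) \<in> L"
proof -
  let ?r = "{(\<phi>, \<psi>). \<phi> \<in> kfms A k \<and> \<psi> \<in> kfms A k \<and> (\<phi> \<^bold>\<longleftrightarrow> \<psi>) \<in> L}"
  have refl: "(\<phi> n, \<phi> n) \<in> ?r" for n
  proof -
    have "(\<phi> n \<^bold>\<longleftrightarrow> \<phi> n) \<in> fms A" "tautology (\<phi> n \<^bold>\<longleftrightarrow> \<phi> n)"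
      using \<phi>[of n] by (auto simp: kfms_def fms_def tautology_def)
    then show ?thesis using L \<phi> by (auto simp: normal_logic_def)
  qed
  have "range (\<lambda>n. ?r `` {\<phi> n}) \<subseteq> kfms A k // ?r"
    using \<phi> by (auto simp: quotient_def)
  then have "finite (range (\<lambda>n. ?r `` {\<phi> n}))"
    using fin unfolding k_finite_def by (rule finite_subset)
  then have "\<not> inj (\<lambda>n. ?r `` {\<phi> n})"
    using finite_imageD infinite_UNIV_nat by blast
  then obtain i j where "i < j" and eq: "?r `` {\<phi> i} = ?r `` {\<phi> j}"
    using linorder_injI[of "\<lambda>n. ?r `` {\<phi> n}"] by blast
  have "\<phi> j \<in> ?r `` {\<phi> j}" using refl by blast
  then have "(\<phi> i \<^bold>\<longleftrightarrow> \<phi> j) \<in> L" unfolding eq[symmetric] by blast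
  with \<open>i < j\<close> show thesis by (rule that)
qed

section \<open>Syntax of the defined modalities\<close>

lemma set_enumeration: "finite A \<Longrightarrow> set (enumeration A) = A"
  unfolding enumeration_def by (rule someI2_ex) (use finite_distinct_list in auto)

lemma modalities_DiaA_pow: "finite A \<Longrightarrow> modalities (DiaA_pow A n \<phi>) \<subseteq> A \<union> modalities \<phi>"
proof (induction n arbitrary: \<phi>)
  case (Suc n)
  have "modalities (DiaA A \<phi>) \<subseteq> A \<union> modalities \<phi>"
    using Suc.prems by (auto simp: DiaA_def set_enumeration)
  with Suc.IH[OF Suc.prems, of "DiaA A \<phi>"] show ?case by auto
qed simp

lemma vars_DiaA_pow: "vars (DiaA_pow A n \<phi>) \<subseteq> vars \<phi>"
proof (induction n arbitrary: \<phi>)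
  case (Suc n)
  have "vars (DiaA A \<phi>) \<subseteq> vars \<phi>" by (auto simp: DiaA_def)
  with Suc[of "DiaA A \<phi>"] show ?case by auto
qed simp

lemma modalities_DiaA_le: "finite A \<Longrightarrow> modalities (DiaA_le A n \<phi>) \<subseteq> A \<union> modalities \<phi>"
  using modalities_DiaA_pow[of A _ \<phi>] by (auto simp: DiaA_le_def simp del: upt_Suc)

lemma vars_DiaA_le: "vars (DiaA_le A n \<phi>) \<subseteq> vars \<phi>"
  using vars_DiaA_pow[of A _ \<phi>] by (auto simp: DiaA_le_def simp del: upt_Suc)

lemma modalities_Bfm: "finite A \<Longrightarrow> modalities (Bfm A m h) \<subseteq> A"
proof (induction h)
  case (Suc h)
  show ?case
    using Suc modalities_DiaA_le[OF Suc.prems, of m "Var (Suc h)"]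
      modalities_DiaA_le[OF Suc.prems, of m "\<^bold>\<not> (DiaA_le A m (Var (Suc h)) \<^bold>\<or> Bfm A m h)"]
    by (auto simp: BoxA_le_def)
qed simp

lemma modalities_relativize: "modalities (relativize \<xi> \<phi>) \<subseteq> modalities \<xi> \<union> modalities \<phi>"
  by (induction \<phi>) auto

lemma vars_relativize: "vars (relativize \<xi> \<phi>) \<subseteq> vars \<xi> \<union> vars \<phi>"
  by (induction \<phi>) auto

text \<open>Fixes the convention for all pigeonhole sequences: variable 1 names the subset, variable
  0 is the only other one, so 2-finiteness applies.\<close>

lemma relativize_in_kfms:
  assumes "modalities \<phi> \<subseteq> A" and "vars \<phi> \<subseteq> {0}"
  shows "relativize (Var 1) \<phi> \<in> kfms A 2"
proof -
  have "modalities (relativize (Var 1) \<phi>) \<subseteq> A"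
    using assms(1) modalities_relativize[of "Var 1" \<phi>] by auto
  moreover have "vars (relativize (Var 1) \<phi>) \<subseteq> {0, 1}"
    using assms(2) vars_relativize[of "Var 1" \<phi>] by auto
  moreover have "{0, 1} = {..<2::nat}"
    by auto
  ultimately show ?thesis
    by (simp add: kfms_def fms_def)
qed

lemma relativize_Disj: "relativize \<xi> (Disj \<phi>s) = Disj (map (relativize \<xi>) \<phi>s)"
  by (induction \<phi>s) (simp_all add: Disj_def Or_def Neg_def)

lemma subst_Disj: "subst \<sigma> (Disj \<phi>s) = Disj (map (subst \<sigma>) \<phi>s)"
  by (induction \<phi>s) (simp_all add: Disj_def Or_def Neg_def)

lemma subst_DiaA_pow: "subst \<sigma> (DiaA_pow A n \<phi>) = DiaA_pow A n (subst \<sigma> \<phi>)"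
  by (induction n arbitrary: \<phi>) (simp_all add: DiaA_def subst_Disj o_def)

lemma subst_DiaA_le: "subst \<sigma> (DiaA_le A n \<phi>) = DiaA_le A n (subst \<sigma> \<phi>)"
  by (simp add: DiaA_le_def subst_Disj o_def subst_DiaA_pow del: upt_Suc)

text \<open>Relativization leaves a variable unchanged but would alter the diamonds of a formula
  substituted for it; hence the restriction to renamings.\<close>

lemma subst_relativize:
  "subst \<sigma> (relativize \<xi> \<phi>) = relativize (subst \<sigma> \<xi>) (subst \<sigma> \<phi>)"
  if "\<And>i. \<exists>j. \<sigma> i = Var j"
proof (induction \<phi>)
  case (Var i)
  then show ?case using that[of i] by auto
qed (simp_all add: And_def Neg_def)

text \<open>One m serves all p and q: the formula is derived for variables 0 and 1 and then
  renamed.\<close>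

lemma relativize_pretransitive:
  assumes "finite A" and L: "normal_logic A L" and "k_finite A 2 L"
  obtains m where "\<And>p q. (Var q \<^bold>\<longrightarrow> relativize (Var q)
    (DiaA_pow A (m + 1) (Var p) \<^bold>\<longrightarrow> DiaA_le A m (Var p))) \<in> L"
proof -
  let ?\<alpha> = "\<lambda>n. relativize (Var 1) (DiaA_le A n (Var 0)) :: 'a fm"
  have "?\<alpha> n \<in> kfms A 2" for n
    using modalities_DiaA_le[OF \<open>finite A\<close>, of n "Var 0"] vars_DiaA_le[of A n "Var 0"]
    by (intro relativize_in_kfms) auto
  from k_finite_pigeonhole[OF L \<open>k_finite A 2 L\<close> this]
  obtain m j where "m < j" and eq: "(?\<alpha> m \<^bold>\<longleftrightarrow> ?\<alpha> j) \<in> L" .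
  let ?\<chi> = "Var 1 \<^bold>\<longrightarrow> relativize (Var 1) (DiaA_pow A (m + 1) (Var 0) \<^bold>\<longrightarrow> DiaA_le A m (Var 0))"
  have "?\<chi> \<in> L"
  proof (rule normal_logic_taut_consequence[OF L eq])
    have "modalities (relativize (Var 1) (DiaA_pow A (m + 1) (Var 0) \<^bold>\<longrightarrow> DiaA_le A m (Var 0))) \<subseteq> A"
      using modalities_relativize[of "Var 1" "DiaA_pow A (m + 1) (Var 0) \<^bold>\<longrightarrow> DiaA_le A m (Var 0)"]
        modalities_DiaA_le[OF \<open>finite A\<close>, of m "Var 0"]
        modalities_DiaA_pow[OF \<open>finite A\<close>, of "m + 1" "Var 0"]
      by (auto simp del: DiaA_pow.simps relativize.simps)
    then show "?\<chi> \<in> fms A" by (simp add: fms_def)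
  next
    fix e :: "'a fm \<Rightarrow> bool"
    assume e: "truth_assignment e" and "e (?\<alpha> m \<^bold>\<longleftrightarrow> ?\<alpha> j)"
    then have "e (?\<alpha> j) \<Longrightarrow> e (?\<alpha> m)" by simp
    \<comment> \<open>Since m + 1 is at most j, this formula is itself one of the disjuncts of
      \<open>?\<alpha> j\<close>.\<close>
    moreover have "e (relativize (Var 1) (DiaA_pow A (m + 1) (Var 0))) \<Longrightarrow> e (?\<alpha> j)"
      using \<open>m < j\<close> e unfolding DiaA_le_def relativize_Disj
      by (auto simp del: upt_Suc DiaA_pow.simps intro!: bexI[of _ "m + 1"])
    ultimately show "e ?\<chi>" using e by (auto simp del: DiaA_pow.simps)
  qed
  have "(Var q \<^bold>\<longrightarrow> relativize (Var q)
      (DiaA_pow A (m + 1) (Var p) \<^bold>\<longrightarrow> DiaA_le A m (Var p))) \<in> L" for p q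
  proof -
    let ?\<sigma> = "\<lambda>i. if i = 0 then Var p else Var q :: 'a fm"
    have "range ?\<sigma> \<subseteq> fms A" by (auto simp: fms_def)
    then have "subst ?\<sigma> ?\<chi> \<in> L" using L \<open>?\<chi> \<in> L\<close> unfolding normal_logic_def by blast
    moreover have "subst ?\<sigma> (relativize (Var 1) \<phi>) = relativize (Var q) (subst ?\<sigma> \<phi>)" for \<phi>
      using subst_relativize[of ?\<sigma> "Var 1" \<phi>] by auto
    ultimately show ?thesis
      by (simp add: subst_DiaA_pow subst_DiaA_le del: DiaA_pow.simps relativize.simps)
  qed
  then show thesis by (rule that)
qed

section \<open>Kripke semantics of the defined modalities\<close>

lemma holds_connectives [simp]:
  "holds F V w (\<^bold>\<not> \<phi>) \<longleftrightarrow> \<not> holds F V w \<phi>"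
  "holds F V w (\<phi> \<^bold>\<or> \<psi>) \<longleftrightarrow> holds F V w \<phi> \<or> holds F V w \<psi>"
  "holds F V w (\<phi> \<^bold>\<and> \<psi>) \<longleftrightarrow> holds F V w \<phi> \<and> holds F V w \<psi>"
  "holds F V w (\<phi> \<^bold>\<longleftrightarrow> \<psi>) \<longleftrightarrow> (holds F V w \<phi> \<longleftrightarrow> holds F V w \<psi>)"
  by (auto simp: Neg_def Or_def And_def Iff_def)

lemma holds_Disj: "holds F V w (Disj \<phi>s) \<longleftrightarrow> (\<exists>\<phi>\<in>set \<phi>s. holds F V w \<phi>)"
  by (induction \<phi>s) (auto simp: Disj_def)

definition union_rel :: "'m set \<Rightarrow> ('m, 'w) frame \<Rightarrow> ('w \<times> 'w) set" where
  "union_rel A F = (\<Union>d\<in>A. snd F d)"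

lemma holds_DiaA_pow:
  assumes "finite A"
  shows "holds F V w (DiaA_pow A n \<phi>) \<longleftrightarrow> (\<exists>v. (w, v) \<in> union_rel A F ^^ n \<and> holds F V v \<phi>)"
proof (induction n arbitrary: \<phi>)
  case (Suc n)
  have "holds F V v (DiaA A \<phi>) \<longleftrightarrow> (\<exists>u. (v, u) \<in> union_rel A F \<and> holds F V u \<phi>)" for v
    by (auto simp: DiaA_def holds_Disj set_enumeration[OF assms] union_rel_def)
  then show ?case by (auto simp: Suc)
qed simp

lemma holds_DiaA_le:
  assumes "finite A"
  shows "holds F V w (DiaA_le A m \<phi>) \<longleftrightarrow>
    (\<exists>v. \<exists>i\<le>m. (w, v) \<in> union_rel A F ^^ i \<and> holds F V v \<phi>)"
  by (simp add: DiaA_le_def holds_Disj holds_DiaA_pow[OF assms] less_Suc_eq_le Bex_def del: upt_Suc)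
    blast

text \<open>Extend a path one edge at a time; whenever its length reaches m + 1, the assumption
  replaces it by one of length at most m.\<close>

lemma pretransitive_rtrancl:
  assumes "\<And>x y. (x, y) \<in> S ^^ Suc m \<Longrightarrow> \<exists>i\<le>m. (x, y) \<in> S ^^ i"
  shows "(x, y) \<in> S\<^sup>* \<longleftrightarrow> (\<exists>i\<le>m. (x, y) \<in> S ^^ i)"
proof
  assume "(x, y) \<in> S\<^sup>*"
  then show "\<exists>i\<le>m. (x, y) \<in> S ^^ i"
  proof (induction rule: rtrancl_induct)
    case base
    then show ?case by (intro exI[of _ 0]) simp
  next
    case (step y z)
    then obtain i where i: "i \<le> m" "(x, z) \<in> S ^^ Suc i" by (auto intro: relcompI)
    show ?case
    proof (cases "i = m")
      case True
      with i assms show ?thesis by blast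
    next
      case False
      with i show ?thesis by (intro exI[of _ "Suc i"]) auto
    qed
  qed
next
  assume "\<exists>i\<le>m. (x, y) \<in> S ^^ i"
  then show "(x, y) \<in> S\<^sup>*" by (auto intro: relpow_imp_rtrancl)
qed

section \<open>Relativization as restriction to a subset of worlds\<close>

definition subframe :: "('m, 'w) frame \<Rightarrow> 'w set \<Rightarrow> ('m, 'w) frame" where
  "subframe F Q = (Q, \<lambda>d. snd F d \<inter> Q \<times> Q)"

text \<open>The guard in each relativized diamond keeps successors inside \<open>V q\<close>; the
  premise on \<open>w\<close> supplies the other endpoint, which \<open>subframe\<close> restricts
  as well.\<close>

lemma holds_relativize:
  "w \<in> V q \<Longrightarrow> holds F V w (relativize (Var q) \<phi>) \<longleftrightarrow> holds (subframe F (V q)) V w \<phi>"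
  by (induction \<phi> arbitrary: w) (auto simp: subframe_def)

text \<open>Evaluation from a world of the frame never leaves the frame, so trimming
  \<open>V\<close> to it changes nothing. Later valuations may thus be arbitrary sets of the
  type.\<close>

lemma frame_valid_holds:
  assumes F: "kripke_frame A F" and \<phi>: "\<phi> \<in> fms A" "frame_valid F \<phi>" and w: "w \<in> fst F"
  shows "holds F V w \<phi>"
proof -
  have "modalities \<psi> \<subseteq> A \<Longrightarrow> u \<in> fst F \<Longrightarrow> holds F V u \<psi> \<longleftrightarrow> holds F (\<lambda>i. V i \<inter> fst F) u \<psi>" for u \<psi>
  proof (induction \<psi> arbitrary: u)
    case (Dia d \<psi>)
    have "snd F d \<subseteq> fst F \<times> fst F" using F Dia.prems by (auto simp: kripke_frame_def)
    with Dia show ?case by (auto 4 3)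
  qed auto
  moreover have "holds F (\<lambda>i. V i \<inter> fst F) w \<phi>"
    using \<phi>(2) w by (auto simp: frame_valid_def)
  ultimately show ?thesis using \<phi>(1) w by (simp add: fms_def)
qed

section \<open>Finite height\<close>

text \<open>If \<open>Bfm\<close> fails at x, its top variable holds at x, and some y above x sees
  no point with that variable and refutes the next lower \<open>Bfm\<close>. So y cannot reach x,
  and the step is strict. The last level contributes a point but no step, whence N steps from index
  N + 1.\<close>

lemma Bfm_refuted_chain:
  assumes "\<not> holds F V x (Bfm A m (Suc N))"
    and S: "\<And>w \<phi>. holds F V w (DiaA_le A m \<phi>) \<longleftrightarrow> (\<exists>v. (w, v) \<in> S\<^sup>* \<and> holds F V v \<phi>)"
  shows "\<exists>c. c N = x \<and> (\<forall>k<N. (c (Suc k), c k) \<in> S\<^sup>* \<and> (c k, c (Suc k)) \<notin> S\<^sup>*)"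
  using assms(1)
proof (induction N arbitrary: x)
  case 0
  show ?case by (intro exI[of _ "\<lambda>_. x"]) simp
next
  case (Suc N)
  from Suc.prems obtain y where x: "x \<in> V (Suc (Suc N))" and "(x, y) \<in> S\<^sup>*"
    and "\<not> holds F V y (DiaA_le A m (Var (Suc (Suc N))))" and y: "\<not> holds F V y (Bfm A m (Suc N))"
    by (subst (asm) Bfm.simps(2)) (auto simp: BoxA_le_def S simp del: Bfm.simps)
  then have xy: "(x, y) \<in> S\<^sup>*" "(y, x) \<notin> S\<^sup>*" by (auto simp: S)
  from Suc.IH[OF y] obtain c where
    "c N = y" "\<forall>k<N. (c (Suc k), c k) \<in> S\<^sup>* \<and> (c k, c (Suc k)) \<notin> S\<^sup>*" by blast
  with xy show ?case
    by (intro exI[of _ "c(Suc N := x)"]) (auto simp: less_Suc_eq)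
qed

text \<open>The chain descends: \<open>c 0\<close> is its top, matching the numbering of the variables in
  \<open>Bfm\<close>. Points below no \<open>c k\<close> share rank \<open>0\<close> with the top.\<close>

lemma descending_chain_rank:
  fixes c :: "nat \<Rightarrow> 'w"
  assumes c: "\<And>k. k < N \<Longrightarrow> (c (Suc k), c k) \<in> S\<^sup>* \<and> (c k, c (Suc k)) \<notin> S\<^sup>*"
  obtains g :: "'w \<Rightarrow> nat" where
    "\<And>x y. (x, y) \<in> S\<^sup>* \<Longrightarrow> g y \<le> g x" "\<And>k. k \<le> N \<Longrightarrow> g (c k) = k"
proof -
  let ?I = "\<lambda>x. {k. k \<le> N \<and> (k = 0 \<or> (x, c k) \<in> S\<^sup>*)}"
  have fin: "finite (?I x)" and ne: "?I x \<noteq> {}" for x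
    by auto
  have desc: "i \<le> j \<Longrightarrow> j \<le> N \<Longrightarrow> (c j, c i) \<in> S\<^sup>*" for i j
    by (induction j rule: dec_induct) (simp_all add: Suc_le_eq, meson c rtrancl_trans)
  \<comment> \<open>A return path from \<open>c i\<close> to \<open>c j\<close> would, preceded by
    the descent from \<open>c (j - 1)\<close> to \<open>c i\<close>, undo the strictness of the
    single step between j - 1 and j.\<close>
  have strict: "(c i, c j) \<notin> S\<^sup>*" if "i < j" "j \<le> N" for i j
  proof
    assume "(c i, c j) \<in> S\<^sup>*"
    moreover have "(c (j - 1), c i) \<in> S\<^sup>*" using that by (intro desc) auto
    ultimately have "(c (j - 1), c j) \<in> S\<^sup>*" by (meson rtrancl_trans)
    moreover have "(c (j - 1), c j) \<notin> S\<^sup>*" using c[of "j - 1"] that by auto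
    ultimately show False by blast
  qed
  show thesis
  proof (rule that[of "\<lambda>x. Max (?I x)"])
    fix x y assume "(x, y) \<in> S\<^sup>*"
    then have "?I y \<subseteq> ?I x" by (auto intro: rtrancl_trans)
    then show "Max (?I y) \<le> Max (?I x)" using ne fin by (intro Max_mono) auto
  next
    fix k assume k: "k \<le> N"
    show "Max (?I (c k)) = k"
    proof (rule Max_eqI[OF fin])
      show "k \<in> ?I (c k)" using k by auto
      show "j \<le> k" if "j \<in> ?I (c k)" for j
        using that strict[of k j] by (cases "k < j") auto
    qed
  qed
qed

section \<open>Parity colouring and alternating paths\<close>

definition parity_literal :: "nat \<Rightarrow> 'm fm" where
  "parity_literal n = (if even n then Var 0 else \<^bold>\<not> Var 0)"

text \<open>At \<open>Suc n\<close> this describes a path through vertices indexed n, ..., 0, each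
  coloured by the parity of its index. Only variable 0 is spent on the colours, leaving variable 1
  for the subset.\<close>

primrec alternation :: "'m set \<Rightarrow> nat \<Rightarrow> nat \<Rightarrow> 'm fm" where
  "alternation A m 0 = \<^bold>\<not> \<^bold>\<bottom>"
| "alternation A m (Suc n) = DiaA_le A m (parity_literal n \<^bold>\<and> alternation A m n)"

lemma modalities_alternation: "finite A \<Longrightarrow> modalities (alternation A m n) \<subseteq> A"
proof (induction n)
  case (Suc n)
  with modalities_DiaA_le[OF Suc.prems, of m "parity_literal n \<^bold>\<and> alternation A m n"]
  show ?case by (auto simp: parity_literal_def split: if_splits)
qed simp

lemma vars_alternation: "vars (alternation A m n) \<subseteq> {0}"
proof (induction n)
  case (Suc n)
  with vars_DiaA_le[of A m "parity_literal n \<^bold>\<and> alternation A m n"]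
  show ?case by (auto simp: parity_literal_def split: if_splits)
qed simp

text \<open>Along an alternating path the rank never increases yet changes parity at each vertex, so
  it drops strictly and must be at least n at the start. Conversely, the chain elements
  \<open>c n\<close>, ..., \<open>c 0\<close> form such a path.\<close>

lemma holds_alternation_iff_rank:
  assumes S: "\<And>w \<phi>. holds F V w (DiaA_le A m \<phi>) \<longleftrightarrow> (\<exists>v. (w, v) \<in> S\<^sup>* \<and> holds F V v \<phi>)"
    and V: "V 0 = {x. even (g x)}"
    and mono: "\<And>x y. (x, y) \<in> S\<^sup>* \<Longrightarrow> g y \<le> g x"
    and gc: "\<And>k. k \<le> N \<Longrightarrow> g (c k) = k"
    and c: "\<And>k. k < N \<Longrightarrow> (c (Suc k), c k) \<in> S\<^sup>*"
  shows "holds F V (c N) (alternation A m (Suc n)) \<longleftrightarrow> n \<le> N"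
proof -
  have lit: "holds F V x (parity_literal k) \<longleftrightarrow> (even (g x) \<longleftrightarrow> even k)" for x k
    by (simp add: parity_literal_def V)
  show ?thesis
  proof
    have "k \<le> g x" if "holds F V x (parity_literal k \<^bold>\<and> alternation A m k)" for x k
      using that
    proof (induction k arbitrary: x)
      case (Suc k)
      then obtain y where "(x, y) \<in> S\<^sup>*" "k \<le> g y" by (auto simp: S)
      then have "k \<le> g x" using mono by (meson le_trans)
      moreover have "even (g x) \<longleftrightarrow> odd k" using Suc.prems by (simp add: lit)
      \<comment> \<open>Parity excludes \<open>g x = k\<close>, which improves the bound to k +
        1.\<close>
      ultimately show ?case by (cases "g x = k") auto
    qed simp
    moreover assume "holds F V (c N) (alternation A m (Suc n))"
    ultimately obtain y where "(c N, y) \<in> S\<^sup>*" "n \<le> g y" by (auto simp: S)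
    then show "n \<le> N" using mono[of "c N" y] gc[of N] by simp
  next
    have step: "holds F V (c k) (parity_literal k \<^bold>\<and> alternation A m k)" if "k \<le> N" for k
      using that
    proof (induction k)
      case 0
      then show ?case by (simp add: lit gc)
    next
      case (Suc k)
      then show ?case using c[of k] by (auto simp: lit gc S)
    qed
    have desc: "(c N, c k) \<in> S\<^sup>*" if "k \<le> N" for k
      using that by (induction k rule: inc_induct) (use c in \<open>auto intro: rtrancl_trans\<close>)
    assume "n \<le> N"
    with step[of n] desc[of n] show "holds F V (c N) (alternation A m (Suc n))"
      by (auto simp: S)
  qed
qed

text \<open>Two equivalent alternation formulas with indices N < j bound the height by N + 1: a
  chain of N + 1 points would have a bottom point satisfying the first and not the second.\<close>

lemma relativize_finite_height:
  assumes "finite A" and L: "normal_logic A L" and fin: "k_finite A 2 L"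
    and pretrans: "(Var 1 \<^bold>\<longrightarrow> relativize (Var 1)
      (DiaA_pow A (m + 1) (Var 0) \<^bold>\<longrightarrow> DiaA_le A m (Var 0))) \<in> L" (is "?\<chi> \<in> L")
    and "kripke_complete TYPE('w) A L"
  shows "\<exists>h. \<forall>q. (Var q \<^bold>\<longrightarrow> relativize (Var q) (Bfm A m h)) \<in> L"
proof -
  from \<open>kripke_complete TYPE('w) A L\<close> obtain \<F> :: "('a, 'w) frame set" where
    \<F>: "\<forall>F\<in>\<F>. kripke_frame A F" and L_eq: "L = {\<phi> \<in> fms A. \<forall>F\<in>\<F>. frame_valid F \<phi>}"
    unfolding kripke_complete_def by blast
  have sound: "holds F V w \<phi>" if "\<phi> \<in> L" "F \<in> \<F>" "w \<in> fst F" for F V w \<phi>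
    using that \<F> frame_valid_holds[of A F \<phi> w V] by (simp add: L_eq)
  have dia: "holds (subframe F Q) V w (DiaA_le A m \<phi>) \<longleftrightarrow>
      (\<exists>v. (w, v) \<in> (union_rel A (subframe F Q))\<^sup>* \<and> holds (subframe F Q) V v \<phi>)"
    if F: "F \<in> \<F>" and Q: "Q \<subseteq> fst F" for F Q V w \<phi>
  proof -
    let ?G = "subframe F Q" and ?S = "union_rel A (subframe F Q)"
    have "\<exists>i\<le>m. (x, y) \<in> ?S ^^ i" if xy: "(x, y) \<in> ?S ^^ Suc m" for x y
    proof -
      have "x \<in> Q" using relpow_Suc_D2[OF xy] by (auto simp: union_rel_def subframe_def)
      \<comment> \<open>The singleton makes the formula from \<open>L\<close> speak about reaching
        exactly y within Q.\<close>
      let ?V = "\<lambda>i::nat. if i = 0 then {y} else Q"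
      have "holds F ?V x ?\<chi>" using \<open>x \<in> Q\<close> F Q pretrans by (intro sound) auto
      then have "holds F ?V x (relativize (Var 1)
          (DiaA_pow A (m + 1) (Var 0) \<^bold>\<longrightarrow> DiaA_le A m (Var 0)))"
        using \<open>x \<in> Q\<close> by (simp del: relativize.simps DiaA_pow.simps)
      then have "holds ?G ?V x (DiaA_pow A (m + 1) (Var 0)) \<longrightarrow> holds ?G ?V x (DiaA_le A m (Var 0))"
        using \<open>x \<in> Q\<close> holds_relativize[of x ?V 1 F] by (simp del: relativize.simps DiaA_pow.simps)
      with xy show ?thesis
        by (auto simp: holds_DiaA_pow[OF \<open>finite A\<close>] holds_DiaA_le[OF \<open>finite A\<close>]
            simp del: DiaA_pow.simps relpow.simps)
    qed
    from pretransitive_rtrancl[OF this] show ?thesis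
      by (auto simp: holds_DiaA_le[OF \<open>finite A\<close>])
  qed
  let ?\<gamma> = "\<lambda>n. relativize (Var 1) (alternation A m (Suc n)) :: 'a fm"
  have "?\<gamma> n \<in> kfms A 2" for n
    by (intro relativize_in_kfms modalities_alternation vars_alternation \<open>finite A\<close>)
  from k_finite_pigeonhole[OF L fin this]
  obtain N j where "N < j" and eq: "(?\<gamma> N \<^bold>\<longleftrightarrow> ?\<gamma> j) \<in> L" .
  have "(Var q \<^bold>\<longrightarrow> relativize (Var q) (Bfm A m (Suc N))) \<in> L" for q
  proof -
    have "holds F V x (relativize (Var q) (Bfm A m (Suc N)))"
      if F: "F \<in> \<F>" and V: "\<forall>i. V i \<subseteq> fst F" and x: "x \<in> V q" for F V x
    proof (rule ccontr)
      let ?G = "subframe F (V q)"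
      let ?S = "union_rel A ?G"
      have Q: "V q \<subseteq> fst F" using V by blast
      assume "\<not> holds F V x (relativize (Var q) (Bfm A m (Suc N)))"
      then have "\<not> holds ?G V x (Bfm A m (Suc N))"
        using holds_relativize[where V = V and q = q, OF x] by blast
      from Bfm_refuted_chain[OF this dia[OF F Q]] obtain c where cN: "c N = x"
        and c: "\<And>k. k < N \<Longrightarrow> (c (Suc k), c k) \<in> ?S\<^sup>* \<and> (c k, c (Suc k)) \<notin> ?S\<^sup>*" by blast
      obtain g :: "'w \<Rightarrow> nat" where mono: "\<And>x y. (x, y) \<in> ?S\<^sup>* \<Longrightarrow> g y \<le> g x"
        and gc: "\<And>k. k \<le> N \<Longrightarrow> g (c k) = k"
        using descending_chain_rank[where c = c and N = N, OF c] by blast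
      \<comment> \<open>The refuting valuation has served to produce the chain. The new one colours
        by rank parity and lets variable 1 name \<open>V q\<close>, so the subframe, and with it
        \<open>?S\<close>, stays the same.\<close>
      let ?V = "\<lambda>i::nat. if i = 0 then {x. even (g x)} else V q"
      have "holds F ?V x (?\<gamma> N \<^bold>\<longleftrightarrow> ?\<gamma> j)" using x F Q by (intro sound[OF eq]) auto
      moreover have "holds F ?V x (?\<gamma> n) \<longleftrightarrow> n \<le> N" for n
      proof -
        have "holds F ?V x (?\<gamma> n) \<longleftrightarrow> holds ?G ?V x (alternation A m (Suc n))"
          using x holds_relativize[of x ?V 1 F] by (simp del: alternation.simps)
        also have "\<dots> \<longleftrightarrow> n \<le> N"
          using holds_alternation_iff_rank[where c = c and g = g and N = N,
              OF dia[OF F Q] _ mono gc] c cN by (simp del: alternation.simps)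
        finally show ?thesis .
      qed
      ultimately show False using \<open>N < j\<close> by (simp del: alternation.simps)
    qed
    moreover have "modalities (relativize (Var q) (Bfm A m (Suc N))) \<subseteq> A"
      using modalities_relativize[of "Var q" "Bfm A m (Suc N)"]
        modalities_Bfm[OF \<open>finite A\<close>, of m "Suc N"] by (auto simp del: Bfm.simps)
    \<comment> \<open>Completeness turns validity in all frames of the class into membership in
      \<open>L\<close>; outside \<open>V q\<close> the implication is vacuous.\<close>
    ultimately show ?thesis
      by (auto simp: L_eq fms_def frame_valid_def simp del: Bfm.simps)
  qed
  then show ?thesis by blast
qed

theorem theorem3p9:
  fixes A :: "'m set" and L :: "'m fm set" and p q :: nat
  assumes "finite A"
    and "normal_logic A L"
    and "k_finite A 2 L"
    and "p \<noteq> q"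
  shows "\<exists>m.
      (Var q \<^bold>\<longrightarrow> relativize (Var q) (DiaA_pow A (m + 1) (Var p) \<^bold>\<longrightarrow> DiaA_le A m (Var p))) \<in> L \<and>
      (kripke_complete TYPE('w) A L \<longrightarrow>
        (\<exists>h. \<forall>q'. q' \<notin> vars (Bfm A m h) \<longrightarrow>
          (Var q' \<^bold>\<longrightarrow> relativize (Var q') (Bfm A m h)) \<in> L))"
proof -
  \<comment> \<open>Keeping p and q general lets the same m give part (1) for the given variables
    and, for variables 0 and 1, the premise of part (2).\<close>
  obtain m where m: "\<And>p q. (Var q \<^bold>\<longrightarrow> relativize (Var q)
      (DiaA_pow A (m + 1) (Var p) \<^bold>\<longrightarrow> DiaA_le A m (Var p))) \<in> L"
    using relativize_pretransitive[OF assms(1-3)] by blast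
  then show ?thesis
    using relativize_finite_height[OF assms(1-3) m, where ?'w = 'w] by blast
qed

end
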